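(* Let $I=[a,b]\subset\mathbb{R}$ be a compact interval. If a function $f:I\to\mathbb{R}$ is Sequential Henstock integrable on $I$, then the value of the integral on $I$ is unique; that is, if $A$ and $B$ are both Sequential Henstock integrals of $f$ on $I$, then $A=B$.
   Context: A tagged partition $P=\{([x_{i-1},x_i],t_i)\}_{i=1}^k$ of $I=[a,b]$ consists of points $a=x_0<x_1<\dots<x_k=b$ together with tags $t_i\in[x_{i-1},x_i]$. Its Riemann sum for $f$ is $S(f,P)=\sum_{i=1}^k f(t_i)(x_i-x_{i-1})$. A gauge on $I$ is a function $\delta:I\to\mathbb{R}$ with $\delta(x)>0$ for all $x\in I$. $P$ is $\delta(x)$-fine if $x_i-x_{i-1}<\delta(t_i)$ for every $i$. For every gauge on $I$, a $\delta(x)$-fine tagged partition of $I$ exists (Cousin's Lemma). $f$ is Sequential Henstock integrable on $I$ if there exist a number $A\in\mathbb{R}$ and a sequence of gauges $\{\delta_n\}_{n=1}^\infty$ on $I$ such that, whenever $P_n$ is a $\delta_n(x)$-fine tagged partition of $I$ for each $n$, one has $S(f,P_n)\to A$ as $n\to\infty$; $A$ is then called a Sequential Henstock integral of $f$ on $I$. *)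

theory Defs
  imports Complex_Main
begin

text \<open>
  A tagged partition \<open>{([x (i - 1), x i], t i)}\<close>, \<open>1 \<le> i \<le> k\<close>, is given by the number \<open>k\<close> of
  subintervals, the points \<open>x 0, \<dots>, x k\<close> and the tags \<open>t 1, \<dots>, t k\<close>; other values of \<open>x\<close> and \<open>t\<close>
  are irrelevant.
\<close>

record tagged_partition =
  len :: nat
  pt :: "nat \<Rightarrow> real"
  tag :: "nat \<Rightarrow> real"

text \<open>
  If \<open>a < b\<close> the endpoint conditions force \<open>len P \<ge> 1\<close>. The only tagged partition of the degenerate
  interval \<open>[a, a]\<close> has no subintervals and Riemann sum 0.
\<close>

definition tagged_partition_on :: "real \<Rightarrow> real \<Rightarrow> tagged_partition \<Rightarrow> bool" where
  "tagged_partition_on a b P \<longleftrightarrow>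
     pt P 0 = a \<and> pt P (len P) = b \<and>
     (\<forall>i\<in>{1..len P}. pt P (i - 1) < pt P i \<and> tag P i \<in> {pt P (i - 1)..pt P i})"

definition riemann_sum :: "(real \<Rightarrow> real) \<Rightarrow> tagged_partition \<Rightarrow> real" where
  "riemann_sum f P = (\<Sum>i=1..len P. f (tag P i) * (pt P i - pt P (i - 1)))"

definition gauge_on :: "real \<Rightarrow> real \<Rightarrow> (real \<Rightarrow> real) \<Rightarrow> bool" where
  "gauge_on a b \<delta> \<longleftrightarrow> (\<forall>x\<in>{a..b}. \<delta> x > 0)"

definition fine_partition :: "(real \<Rightarrow> real) \<Rightarrow> tagged_partition \<Rightarrow> bool" where
  "fine_partition \<delta> P \<longleftrightarrow> (\<forall>i\<in>{1..len P}. pt P i - pt P (i - 1) < \<delta> (tag P i))"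

text \<open>
  Functions on \<open>[a, b]\<close> are represented by total functions, of which only the values on \<open>{a..b}\<close>
  enter. Sequences are indexed from 0 instead of 1.
\<close>

definition has_sequential_Henstock_integral ::
    "(real \<Rightarrow> real) \<Rightarrow> real \<Rightarrow> real \<Rightarrow> real \<Rightarrow> bool" where
  "has_sequential_Henstock_integral f a b A \<longleftrightarrow>
     (\<exists>\<delta> :: nat \<Rightarrow> real \<Rightarrow> real.
        (\<forall>n. gauge_on a b (\<delta> n)) \<and>
        (\<forall>P :: nat \<Rightarrow> tagged_partition.
           (\<forall>n. tagged_partition_on a b (P n) \<and> fine_partition (\<delta> n) (P n)) \<longrightarrow>
           (\<lambda>n. riemann_sum f (P n)) \<longlonglongrightarrow> A))"

definition sequential_Henstock_integrable :: "(real \<Rightarrow> real) \<Rightarrow> real \<Rightarrow> real \<Rightarrow> bool" where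
  "sequential_Henstock_integrable f a b \<longleftrightarrow> (\<exists>A. has_sequential_Henstock_integral f a b A)"

end

theory Submission
  imports Defs
begin

text \<open>
  A common refinement of the two witnessing sequences of gauges settles the matter. If \<open>\<delta>\<close> witnesses
  \<open>A\<close> and \<open>\<eta>\<close> witnesses \<open>B\<close>, then for each \<open>n\<close> the pointwise minimum of \<open>\<delta> n\<close> and \<open>\<eta> n\<close> is again a
  gauge, and a partition that is fine for the minimum is fine for both. Cousin's Lemma
  (\<open>ex_fine_partition\<close>) provides such a partition for every \<open>n\<close>; the resulting single sequence of
  Riemann sums converges both to \<open>A\<close> and to \<open>B\<close>, so \<open>A = B\<close> because limits are unique. Without
  Cousin's Lemma both convergence conditions could be vacuous.

  Cousin's Lemma itself follows from the bisection principle for compact intervals: having a fine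
  partition is inherited by a union of two adjacent intervals, and it holds for every sufficiently
  short interval around a point \<open>x\<close>, since that interval alone, tagged by \<open>x\<close>, is a fine partition.
\<close>

text \<open>
  The subintervals of the second partition are renumbered to follow those of the first. The two
  descriptions of the point with index \<open>len P\<close> agree because both are the common endpoint \<open>v\<close>.
\<close>

lemma fine_partition_adjacent:
  assumes P: "tagged_partition_on u v P" "fine_partition \<delta> P"
    and Q: "tagged_partition_on v w Q" "fine_partition \<delta> Q"
  shows "\<exists>R. tagged_partition_on u w R \<and> fine_partition \<delta> R"
proof -
  define R where "R = \<lparr>len = len P + len Q,
    pt = (\<lambda>i. if i \<le> len P then pt P i else pt Q (i - len P)),
    tag = (\<lambda>i. if i \<le> len P then tag P i else tag Q (i - len P))\<rparr>"
  have join: "pt P (len P) = pt Q 0"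
    using P(1) Q(1) by (simp add: tagged_partition_on_def)
  have left: "pt R i = pt P i" "pt R (i - 1) = pt P (i - 1)" "tag R i = tag P i"
    if "i \<le> len P" for i
    using that by (auto simp: R_def)
  have right: "pt R i = pt Q (i - len P)" "pt R (i - 1) = pt Q (i - len P - 1)"
    "tag R i = tag Q (i - len P)" if "i > len P" for i
  proof -
    show "pt R i = pt Q (i - len P)" "tag R i = tag Q (i - len P)"
      using that by (simp_all add: R_def)
    show "pt R (i - 1) = pt Q (i - len P - 1)"
    proof (cases "i = Suc (len P)")
      case True
      then show ?thesis using join by (simp add: R_def)
    next
      case False
      with that have "\<not> i - 1 \<le> len P" "i - 1 - len P = i - len P - 1" by auto
      then show ?thesis by (simp add: R_def)
    qed
  qed
  have step: "pt R (i - 1) < pt R i \<and> tag R i \<in> {pt R (i - 1)..pt R i}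
      \<and> pt R i - pt R (i - 1) < \<delta> (tag R i)" if i: "i \<in> {1..len R}" for i
  proof (cases "i \<le> len P")
    case True
    then have "i \<in> {1..len P}" using i by simp
    then show ?thesis
      using P unfolding left[OF True] tagged_partition_on_def fine_partition_def by blast
  next
    case False
    then have gt: "i > len P" by simp
    then have "i - len P \<in> {1..len Q}" using i by (auto simp: R_def)
    then show ?thesis
      using Q unfolding right[OF gt] tagged_partition_on_def fine_partition_def by blast
  qed
  have "pt R 0 = u" "pt R (len R) = w"
    using P(1) Q(1) by (auto simp: R_def tagged_partition_on_def)
  with step show ?thesis
    unfolding tagged_partition_on_def fine_partition_def by blast
qed

text \<open>
  Bisection may ask for the degenerate interval \<open>[x, x]\<close>. It has only the empty partition, hence the
  length 0 in that case.
\<close>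

lemma fine_partition_short_interval:
  assumes "u \<le> x" "x \<le> v" "v - u < \<delta> x"
  shows "\<exists>P. tagged_partition_on u v P \<and> fine_partition \<delta> P"
proof -
  define P where "P = \<lparr>len = (if u = v then 0 else 1),
    pt = (\<lambda>i. if i = 0 then u else v), tag = (\<lambda>_. x)\<rparr>"
  have "tagged_partition_on u v P" "fine_partition \<delta> P"
    using assms by (auto simp: P_def tagged_partition_on_def fine_partition_def)
  then show ?thesis by blast
qed

text \<open>Cousin's Lemma; the radius around \<open>x\<close> needed for bisection is \<open>\<delta> x\<close> itself.\<close>

lemma ex_fine_partition:
  assumes "a \<le> b" and "gauge_on a b \<delta>"
  shows "\<exists>P. tagged_partition_on a b P \<and> fine_partition \<delta> P"
  using \<open>a \<le> b\<close>
proof (induction rule: Bolzano)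
  case (trans u v w)
  then show ?case using fine_partition_adjacent by blast
next
  case (local x)
  then have "\<delta> x > 0" using assms(2) by (simp add: gauge_on_def)
  then show ?case using fine_partition_short_interval by blast
qed

theorem theorem4:
  fixes f :: "real \<Rightarrow> real" and a b A B :: real
  assumes "a \<le> b"
    and "sequential_Henstock_integrable f a b"
    and "has_sequential_Henstock_integral f a b A"
    and "has_sequential_Henstock_integral f a b B"
  shows "A = B"
proof -
  obtain \<delta> where \<delta>: "\<And>n. gauge_on a b (\<delta> n)"
    and limA: "\<And>P. (\<And>n. tagged_partition_on a b (P n) \<and> fine_partition (\<delta> n) (P n))
      \<Longrightarrow> (\<lambda>n. riemann_sum f (P n)) \<longlonglongrightarrow> A"
    using assms(3) unfolding has_sequential_Henstock_integral_def by blast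
  obtain \<eta> where \<eta>: "\<And>n. gauge_on a b (\<eta> n)"
    and limB: "\<And>P. (\<And>n. tagged_partition_on a b (P n) \<and> fine_partition (\<eta> n) (P n))
      \<Longrightarrow> (\<lambda>n. riemann_sum f (P n)) \<longlonglongrightarrow> B"
    using assms(4) unfolding has_sequential_Henstock_integral_def by blast
  have "gauge_on a b (\<lambda>x. min (\<delta> n x) (\<eta> n x))" for n
    using \<delta>[of n] \<eta>[of n] by (simp add: gauge_on_def)
  then have "\<exists>P. tagged_partition_on a b P \<and> fine_partition (\<lambda>x. min (\<delta> n x) (\<eta> n x)) P" for n
    using ex_fine_partition[OF \<open>a \<le> b\<close>] by blast
  then obtain P where P: "\<And>n. tagged_partition_on a b (P n)"
    "\<And>n. fine_partition (\<lambda>x. min (\<delta> n x) (\<eta> n x)) (P n)"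
    by metis
  have "fine_partition (\<delta> n) (P n)" "fine_partition (\<eta> n) (P n)" for n
    using P(2)[of n] by (auto simp: fine_partition_def)
  then have "(\<lambda>n. riemann_sum f (P n)) \<longlonglongrightarrow> A" "(\<lambda>n. riemann_sum f (P n)) \<longlonglongrightarrow> B"
    using limA limB P(1) by blast+
  then show "A = B" by (rule LIMSEQ_unique)
qed

end
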